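(* Let $a, M$ be positive integers. Let $I_g, I_h$ be finite intervals of lengths $L_g$ and $L_h$, respectively, with nonempty intersection. Let $g \in \ell^2(\mathbb{Z})$ satisfy $\operatorname{supp}(g) \subseteq I_g$ (so that $\mathcal{G}(g,a,M)$ is a Gabor system with window supported in $I_g$), and let $h \in \ell^2(\mathbb{Z})$ satisfy $\operatorname{supp}(h) \subseteq I_h$. Then all but at most $a\left\lceil \frac{L_g+L_h}{M}\right\rceil$ of the Wexler-Raz equations $$\frac{M}{a}\left\langle h,\, g[\cdot - nM]\, e^{2\pi i m \cdot/a}\right\rangle_{\ell^2} = \delta[n]\,\delta[m], \qquad m=0,\ldots,a-1,\ n\in\mathbb{Z},$$ are trivially satisfied. Moreover, if $\langle h, g\rangle_{\ell^2} = a/M$, then the following are equivalent: (i) $g, h$ are Gabor dual windows on $\ell^2(\mathbb{Z})$ for $a, M$. (ii) For any integer $L > L_g + L_h$ with $a \mid L$ and $M \mid L$, the vectors $g_{fin}, h_{fin} \in \mathbb{C}^L$ defined by $g_{fin}[l] = \sum_{k\in\mathbb{Z}} g[l-kL]$ and $h_{fin}[l] = \sum_{k\in\mathbb{Z}} h[l-kL]$ for $l=0,\ldots,L-1$ are Gabor dual windows on $\mathbb{C}^L$ for $a, M$. Moreover, the implication (i)$\Rightarrow$(ii) holds for any $L \geq L_g, L_h$ with $a\mid L$ and $M \mid L$; that is, if (i) holds, then for every integer $L \geq \max(L_g,L_h)$ divisible by $a$ and by $M$, the vectors $g_{fin}, h_{fin}\in\mathbb{C}^L$ defined as in (ii) are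 Gabor dual windows on $\mathbb{C}^L$ for $a, M$.
   Context: Inner products: $\langle f, u\rangle = \sum_l f[l]\overline{u[l]}$, over $l\in\mathbb{Z}$ for $\ell^2(\mathbb{Z})$ and over $l=0,\ldots,L-1$ for $\mathbb{C}^L$. $\delta$ denotes the Kronecker delta ($\delta[0]=1$, $\delta[k]=0$ for $k\neq 0$). The support $\operatorname{supp}(f)$ of a sequence is the smallest closed interval containing all indices at which $f$ is nonzero. Intervals are intervals of integer indices, and the length of an interval is the number of samples (integers) it contains. $\mathbb{C}^L$ is regarded as the space of $L$-periodic sequences, with indices taken modulo $L$. Translation and modulation: $\mathbf{T}_n f[l] = f[l-n]$ and $\mathbf{M}_\omega f[l] = f[l]e^{2\pi i\omega l}$; on $\mathbb{C}^L$ the same formulas are used with indices modulo $L$. Gabor system: for a window $g\in\ell^2(\mathbb{Z})$, a hop size $a$ and a number of frequency bins $M$, $\mathcal{G}(g,a,M) = (g_{m,n})_{n\in\mathbb{Z},\ m=0,\ldots,M-1}$ with $g_{m,n} = \mathbf{M}_{m/M}\mathbf{T}_{na}g$. On $\mathbb{C}^L$ with $a\mid L$, $M\mid L$, the system is defined by the same formula with $n=0,\ldots,L/a-1$ and circular translation. Gabor dual windows: $g,h$ are Gabor dual windows on $\ell^2(\mathbb{Z})$ for $a,M$ if $$f=\sum_{n\in\mathbb{Z}}\sum_{m=0}^{M-1}\langle f, g_{m,n}\rangle h_{m,n} = \sum_{n\in\mathbb{Z}}\sum_{m=0}^{M-1}\langle f, h_{m,n}\rangle g_{m,n}\quad\text{for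 all } f\in\ell^2(\mathbb{Z}).$$ Gabor dual windows on $\mathbb{C}^L$ for $a,M$ are defined in the same way, for all $f\in\mathbb{C}^L$, with $n$ ranging over $0,\ldots,L/a-1$. The Wexler-Raz equation indexed by $(m,n)$ is "trivially satisfied" if $n\neq 0$ and $I_h\cap(I_g+nM)=\emptyset$, so that both of its sides are zero because the supports are disjoint. *)

theory Defs
  imports "HOL-Analysis.Analysis"
begin

definition ell2 :: "(int \<Rightarrow> complex) set" where
  "ell2 = {f. (\<lambda>l. (cmod (f l))\<^sup>2) summable_on UNIV}"

definition ell2_inner :: "(int \<Rightarrow> complex) \<Rightarrow> (int \<Rightarrow> complex) \<Rightarrow> complex" where
  "ell2_inner f u = (\<Sum>\<^sub>\<infinity>l. f l * cnj (u l))"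

definition ell2_norm :: "(int \<Rightarrow> complex) \<Rightarrow> real" where
  "ell2_norm f = sqrt (\<Sum>\<^sub>\<infinity>l. (cmod (f l))\<^sup>2)"

text \<open>The space of complex vectors of length \<open>L\<close> is modelled by the \<open>L\<close>-periodic sequences on the
  integers, so that translation and modulation are given by the same formulas in both settings.\<close>

definition periodic_seqs :: "nat \<Rightarrow> (int \<Rightarrow> complex) set" where
  "periodic_seqs L = {f. \<forall>l. f (l + int L) = f l}"

definition fin_inner :: "nat \<Rightarrow> (int \<Rightarrow> complex) \<Rightarrow> (int \<Rightarrow> complex) \<Rightarrow> complex" where
  "fin_inner L f u = (\<Sum>l\<in>{0..<int L}. f l * cnj (u l))"

definition kdelta :: "int \<Rightarrow> complex" where
  "kdelta k = (if k = 0 then 1 else 0)"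

definition int_interval :: "int set \<Rightarrow> bool" where
  "int_interval I \<longleftrightarrow> (\<forall>x\<in>I. \<forall>y\<in>I. {x..y} \<subseteq> I)"

text \<open>The smallest interval (possibly empty or unbounded) containing all indices at which \<open>f\<close> is
  nonzero.\<close>

definition supp :: "(int \<Rightarrow> complex) \<Rightarrow> int set" where
  "supp f = int_interval hull {l. f l \<noteq> 0}"

definition translate :: "int \<Rightarrow> (int \<Rightarrow> complex) \<Rightarrow> (int \<Rightarrow> complex)" where
  "translate n f = (\<lambda>l. f (l - n))"

definition modulate :: "real \<Rightarrow> (int \<Rightarrow> complex) \<Rightarrow> (int \<Rightarrow> complex)" where
  "modulate \<omega> f = (\<lambda>l. f l * exp (2 * of_real pi * \<i> * of_real \<omega> * of_int l))"

definition gabor :: "(int \<Rightarrow> complex) \<Rightarrow> nat \<Rightarrow> nat \<Rightarrow> int \<Rightarrow> int \<Rightarrow> (int \<Rightarrow> complex)" where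
  "gabor g a M m n = modulate (of_int m / of_nat M) (translate (n * int a) g)"

text \<open>The series over \<open>n\<close> is understood as an unconditionally convergent series in the
  square-summable norm.\<close>

definition ell2_expansion ::
    "(int \<Rightarrow> complex) \<Rightarrow> (int \<Rightarrow> complex) \<Rightarrow> nat \<Rightarrow> nat \<Rightarrow> (int \<Rightarrow> complex) \<Rightarrow> bool" where
  "ell2_expansion g h a M f \<longleftrightarrow>
     ((\<lambda>N. ell2_norm (\<lambda>l. f l -
          (\<Sum>n\<in>N. \<Sum>m\<in>{0..<int M}. ell2_inner f (gabor g a M m n) * gabor h a M m n l)))
        \<longlongrightarrow> 0) (finite_subsets_at_top UNIV)"

definition ell2_dual_windows ::
    "(int \<Rightarrow> complex) \<Rightarrow> (int \<Rightarrow> complex) \<Rightarrow> nat \<Rightarrow> nat \<Rightarrow> bool" where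
  "ell2_dual_windows g h a M \<longleftrightarrow> g \<in> ell2 \<and> h \<in> ell2 \<and>
     (\<forall>f\<in>ell2. ell2_expansion g h a M f \<and> ell2_expansion h g a M f)"

definition fin_expansion ::
    "nat \<Rightarrow> (int \<Rightarrow> complex) \<Rightarrow> (int \<Rightarrow> complex) \<Rightarrow> nat \<Rightarrow> nat \<Rightarrow> (int \<Rightarrow> complex) \<Rightarrow> bool" where
  "fin_expansion L g h a M f \<longleftrightarrow>
     f = (\<lambda>l. \<Sum>n\<in>{0..<int (L div a)}. \<Sum>m\<in>{0..<int M}.
            fin_inner L f (gabor g a M m n) * gabor h a M m n l)"

definition fin_dual_windows ::
    "nat \<Rightarrow> (int \<Rightarrow> complex) \<Rightarrow> (int \<Rightarrow> complex) \<Rightarrow> nat \<Rightarrow> nat \<Rightarrow> bool" where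
  "fin_dual_windows L g h a M \<longleftrightarrow> g \<in> periodic_seqs L \<and> h \<in> periodic_seqs L \<and>
     (\<forall>f\<in>periodic_seqs L. fin_expansion L g h a M f \<and> fin_expansion L h g a M f)"

definition periodization :: "nat \<Rightarrow> (int \<Rightarrow> complex) \<Rightarrow> (int \<Rightarrow> complex)" where
  "periodization L g = (\<lambda>l. \<Sum>\<^sub>\<infinity>k. g (l - k * int L))"

definition wexler_raz_lhs ::
    "(int \<Rightarrow> complex) \<Rightarrow> (int \<Rightarrow> complex) \<Rightarrow> nat \<Rightarrow> nat \<Rightarrow> int \<Rightarrow> int \<Rightarrow> complex" where
  "wexler_raz_lhs g h a M m n =
     of_nat M / of_nat a *
       ell2_inner h (\<lambda>l. g (l - n * int M) * exp (2 * of_real pi * \<i> * of_int m * of_int l / of_nat a))"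

definition wexler_raz_rhs :: "int \<Rightarrow> int \<Rightarrow> complex" where
  "wexler_raz_rhs m n = kdelta n * kdelta m"

definition wexler_raz_trivial :: "int set \<Rightarrow> int set \<Rightarrow> nat \<Rightarrow> int \<Rightarrow> int \<Rightarrow> bool" where
  "wexler_raz_trivial Ig Ih M m n \<longleftrightarrow> n \<noteq> 0 \<and> Ih \<inter> (\<lambda>l. l + n * int M) ` Ig = {}"

end

theory Submission imports Defs begin

text \<open>Expand the frame-type operator \<open>f \<mapsto> \<Sum>\<^sub>n \<Sum>\<^sub>m \<langle>f, g\<^sub>m\<^sub>n\<rangle> h\<^sub>m\<^sub>n\<close>
  as an integral kernel. Summing over \<open>m\<close> first, the kernel vanishes unless \<open>M\<close> divides
  \<open>l - l'\<close>, and then it is \<open>M R(l, l')\<close> with the correlation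
  \<open>R(l, l') = \<Sum>\<^sub>n cnj (g (l' - n a)) h (l - n a)\<close>. Duality on the integers thus means
  \<open>M R(l, l') = \<delta>(l - l')\<close> whenever \<open>M\<close> divides \<open>l - l'\<close>, and duality of the
  periodized windows is the same statement modulo \<open>L\<close>. The correlation of the periodizations is
  \<open>R\<^sub>L(l, l') = \<Sum>\<^sub>j R(l, l' - j L)\<close>, so the first condition always implies the second.
  Conversely \<open>R(l, l')\<close> is nonzero only if \<open>l' - l\<close> lies in the difference set of the two
  intervals, which contains 0 and has diameter at most \<open>L\<^sub>g + L\<^sub>h - 2\<close>; hence for
  \<open>L > L\<^sub>g + L\<^sub>h\<close> the sum has at most one nonzero term and no wrap-around occurs.\<close>

subsection \<open>Correlations of windows\<close>

text \<open>The terms are the powers of an \<open>M\<close>-th root of unity \<open>z\<close>, which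
  equals 1 exactly when \<open>M\<close> divides \<open>d\<close>; otherwise the geometric sum has
  numerator \<open>1 - z ^ M = 0\<close>.\<close>

lemma sum_exp_residues:
  fixes d :: int
  assumes "M > 0"
  shows "(\<Sum>m\<in>{0..<int M}. exp (2 * of_real pi * \<i> * of_int m * of_int d / of_nat M))
           = (if int M dvd d then of_nat M else (0::complex))"
proof -
  define z :: complex where "z = exp (2 * of_real pi * \<i> * of_int d / of_nat M)"
  have pow: "z ^ k = exp (2 * of_real pi * \<i> * of_nat k * of_int d / of_nat M)" for k :: nat
    by (simp add: z_def exp_of_nat_mult [symmetric] mult_ac)
  have "(\<Sum>m\<in>{0..<int M}. exp (2 * of_real pi * \<i> * of_int m * of_int d / of_nat M))
          = (\<Sum>k<M. z ^ k)"
    unfolding pow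
    by (rule sum.reindex_bij_witness [of _ int nat]) auto
  also have "\<dots> = (if int M dvd d then of_nat M else 0)"
  proof (cases "int M dvd d")
    case True
    then obtain c where "d = int M * c" ..
    with assms have "z = exp ((2 * of_int c * of_real pi) * \<i>)"
      by (simp add: z_def mult_ac)
    also have "\<dots> = 1" using exp_integer_2pi [of "of_int c"] by simp
    finally show ?thesis using True by simp
  next
    case False
    have "z \<noteq> 1"
    proof
      assume "z = 1"
      then obtain n :: int where "2 * pi * of_int d / of_nat M = of_int (2 * n) * pi"
        by (auto simp: z_def exp_eq_1)
      with assms have "of_int d = real_of_int (n * int M)" by (simp add: field_simps)
      then have "d = n * int M" by linarith
      with False show False by simp
    qed
    moreover have "z ^ M = 1"
    proof -
      have "z ^ M = exp ((2 * of_int d * of_real pi) * \<i>)"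
        using assms by (simp add: pow mult_ac)
      also have "\<dots> = 1" using exp_integer_2pi [of "of_int d"] by simp
      finally show ?thesis .
    qed
    ultimately show ?thesis using False by (simp add: sum_gp_strict)
  qed
  finally show ?thesis .
qed

text \<open>The translates do not depend on \<open>m\<close>, so only phases are summed. This
  orthogonality confines the kernel to pairs congruent modulo \<open>M\<close>.\<close>

lemma sum_gabor_product:
  assumes "M > 0"
  shows "(\<Sum>m\<in>{0..<int M}. cnj (gabor g a M m n l') * gabor h a M m n l)
           = (if int M dvd l - l' then of_nat M else 0) *
             (cnj (g (l' - n * int a)) * h (l - n * int a))"
proof -
  have "cnj (gabor g a M m n l') * gabor h a M m n l
          = exp (2 * of_real pi * \<i> * of_int m * of_int (l - l') / of_nat M) *
            (cnj (g (l' - n * int a)) * h (l - n * int a))" for m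
    by (simp add: gabor_def modulate_def translate_def exp_cnj diff_divide_distrib
        exp_diff exp_minus field_simps)
  then show ?thesis
    by (simp add: sum_distrib_right [symmetric] sum_exp_residues [OF assms] del: of_int_diff)
qed

text \<open>Up to the factor \<open>M\<close>, an entry of the Walnut matrix of the mixed frame
  operator. For finitely supported windows and positive \<open>a\<close> only finitely many terms
  are nonzero.\<close>

definition window_corr ::
    "(int \<Rightarrow> complex) \<Rightarrow> (int \<Rightarrow> complex) \<Rightarrow> nat \<Rightarrow> int \<Rightarrow> int \<Rightarrow> complex" where
  "window_corr g h a l l' = (\<Sum>\<^sub>\<infinity>n. cnj (g (l' - n * int a)) * h (l - n * int a))"

definition fin_window_corr ::
    "nat \<Rightarrow> (int \<Rightarrow> complex) \<Rightarrow> (int \<Rightarrow> complex) \<Rightarrow> nat \<Rightarrow> int \<Rightarrow> int \<Rightarrow> complex" where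
  "fin_window_corr L g h a l l' =
     (\<Sum>n\<in>{0..<int (L div a)}. cnj (g (l' - n * int a)) * h (l - n * int a))"

text \<open>The Wexler-Raz system in the time domain: for finitely supported windows and fixed
  \<open>l - l' = n * int M\<close> the correlation is \<open>a\<close>-periodic in
  \<open>l\<close>, and \<open>M\<close> times its Fourier coefficients are the Wexler-Raz left
  sides with index \<open>n\<close>.\<close>

definition corr_cond :: "(int \<Rightarrow> complex) \<Rightarrow> (int \<Rightarrow> complex) \<Rightarrow> nat \<Rightarrow> nat \<Rightarrow> bool" where
  "corr_cond g h a M \<longleftrightarrow> (\<forall>l l'. int M dvd l - l' \<longrightarrow>
     of_nat M * window_corr g h a l l' = (if l = l' then 1 else 0))"

text \<open>Residues are represented by integers, so equality of indices becomes congruence modulo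
  \<open>L\<close>.\<close>

definition fin_corr_cond ::
    "nat \<Rightarrow> (int \<Rightarrow> complex) \<Rightarrow> (int \<Rightarrow> complex) \<Rightarrow> nat \<Rightarrow> nat \<Rightarrow> bool" where
  "fin_corr_cond L g h a M \<longleftrightarrow> (\<forall>l l'. int M dvd l - l' \<longrightarrow>
     of_nat M * fin_window_corr L g h a l l' = (if int L dvd l - l' then 1 else 0))"

lemma window_corr_swap: "window_corr h g a l l' = cnj (window_corr g h a l' l)"
  by (simp add: window_corr_def infsum_cnj [symmetric] mult.commute)

lemma fin_window_corr_swap: "fin_window_corr L h g a l l' = cnj (fin_window_corr L g h a l' l)"
  by (simp add: fin_window_corr_def mult.commute)

text \<open>Duality asks for two expansions. Exchanging the windows conjugates the correlation and
  transposes its arguments, and the prescribed values are real and symmetric, so one condition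
  serves both.\<close>

lemma corr_cond_swap:
  assumes "corr_cond g h a M"
  shows "corr_cond h g a M"
  unfolding corr_cond_def
proof (intro allI impI)
  fix l l' :: int assume "int M dvd l - l'"
  then have "int M dvd l' - l" by (simp add: dvd_diff_commute)
  with assms have "of_nat M * window_corr g h a l' l = (if l' = l then 1 else 0)"
    by (simp add: corr_cond_def)
  then have "cnj (of_nat M * window_corr g h a l' l) = (if l = l' then 1 else 0)" by simp
  then show "of_nat M * window_corr h g a l l' = (if l = l' then 1 else 0)"
    by (simp add: window_corr_swap [of h])
qed

lemma fin_corr_cond_swap:
  assumes "fin_corr_cond L g h a M"
  shows "fin_corr_cond L h g a M"
  unfolding fin_corr_cond_def
proof (intro allI impI)
  fix l l' :: int assume "int M dvd l - l'"
  then have "int M dvd l' - l" by (simp add: dvd_diff_commute)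
  with assms have "of_nat M * fin_window_corr L g h a l' l = (if int L dvd l' - l then 1 else 0)"
    by (simp add: fin_corr_cond_def)
  then have "cnj (of_nat M * fin_window_corr L g h a l' l) = (if int L dvd l - l' then 1 else 0)"
    by (simp add: dvd_diff_commute)
  then show "of_nat M * fin_window_corr L h g a l l' = (if int L dvd l - l' then 1 else 0)"
    by (simp add: fin_window_corr_swap [of _ h])
qed

subsection \<open>Duality for periodic sequences\<close>

lemma periodic_shift:
  assumes "f \<in> periodic_seqs L"
  shows "f (l + k * int L) = f l"
proof -
  have step: "f (x + int L) = f x" for x using assms by (simp add: periodic_seqs_def)
  have nat: "f (x + int n * int L) = f x" for n x
  proof (induction n)
    case (Suc n)
    with step [of "x + int n * int L"] show ?case by (simp add: algebra_simps)
  qed simp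
  show ?thesis
  proof (cases "k \<ge> 0")
    case True
    then show ?thesis using nat [of l "nat k"] by simp
  next
    case False
    then show ?thesis using nat [of "l + k * int L" "nat (- k)"] by simp
  qed
qed

lemma periodic_cong:
  assumes "f \<in> periodic_seqs L" "int L dvd l - l'"
  shows "f l = f l'"
proof -
  from assms(2) obtain k where "l - l' = int L * k" ..
  then have "l = l' + k * int L" by (simp add: algebra_simps)
  then show ?thesis using periodic_shift [OF assms(1)] by simp
qed

lemma sum_residue_class:
  fixes F :: "int \<Rightarrow> complex"
  assumes "L > 0"
  shows "(\<Sum>l'\<in>{0..<int L}. F l' * (if int L dvd l' - l then 1 else 0)) = F (l mod int L)"
proof -
  have "int L dvd l' - l \<longleftrightarrow> l' = l mod int L" if "l' \<in> {0..<int L}" for l'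
    using that mod_eq_dvd_iff [of l' "int L" l] by auto
  then have "(\<Sum>l'\<in>{0..<int L}. F l' * (if int L dvd l' - l then 1 else 0))
     = (\<Sum>l'\<in>{0..<int L}. if l' = l mod int L then F l' else 0)"
    by (intro sum.cong) auto
  also have "\<dots> = F (l mod int L)" using assms by (simp add: sum.delta)
  finally show ?thesis .
qed

text \<open>Once the sum over \<open>m\<close> is innermost, orthogonality collapses it, and the
  remaining sum over \<open>n\<close> is the correlation.\<close>

lemma fin_frame_sum:
  assumes "M > 0"
  shows "(\<Sum>n\<in>{0..<int (L div a)}. \<Sum>m\<in>{0..<int M}.
            fin_inner L f (gabor g a M m n) * gabor h a M m n l)
         = (\<Sum>l'\<in>{0..<int L}. f l' *
              ((if int M dvd l - l' then of_nat M else 0) * fin_window_corr L g h a l l'))"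
proof -
  have "(\<Sum>n\<in>{0..<int (L div a)}. \<Sum>m\<in>{0..<int M}.
            fin_inner L f (gabor g a M m n) * gabor h a M m n l)
     = (\<Sum>n\<in>{0..<int (L div a)}. \<Sum>m\<in>{0..<int M}. \<Sum>l'\<in>{0..<int L}.
          f l' * (cnj (gabor g a M m n l') * gabor h a M m n l))"
    by (simp add: fin_inner_def sum_distrib_right mult.assoc)
  also have "\<dots> = (\<Sum>n\<in>{0..<int (L div a)}. \<Sum>l'\<in>{0..<int L}. \<Sum>m\<in>{0..<int M}.
          f l' * (cnj (gabor g a M m n l') * gabor h a M m n l))"
    by (rule sum.cong [OF refl], rule sum.swap)
  also have "\<dots> = (\<Sum>l'\<in>{0..<int L}. \<Sum>n\<in>{0..<int (L div a)}. \<Sum>m\<in>{0..<int M}.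
          f l' * (cnj (gabor g a M m n l') * gabor h a M m n l))"
    by (rule sum.swap)
  also have "\<dots> = (\<Sum>l'\<in>{0..<int L}. \<Sum>n\<in>{0..<int (L div a)}. f l' *
          ((if int M dvd l - l' then of_nat M else 0) *
             (cnj (g (l' - n * int a)) * h (l - n * int a))))"
    by (simp only: sum_distrib_left [symmetric] sum_gabor_product [OF assms])
  also have "\<dots> = (\<Sum>l'\<in>{0..<int L}. f l' *
              ((if int M dvd l - l' then of_nat M else 0) * fin_window_corr L g h a l l'))"
    by (simp only: sum_distrib_left [symmetric] fin_window_corr_def)
  finally show ?thesis .
qed

lemma fin_expansion_if_fin_corr_cond:
  assumes "L > 0" "M > 0" "M dvd L" and f: "f \<in> periodic_seqs L" and "fin_corr_cond L g h a M"
  shows "fin_expansion L g h a M f"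
proof -
  \<comment> \<open>Since \<open>M\<close> divides \<open>L\<close>, pairs not congruent modulo
    \<open>M\<close> are not congruent modulo \<open>L\<close> either. The kernel is thus the
    periodic identity on all pairs, including those on which the condition is silent.\<close>
  have kernel: "(if int M dvd l - l' then of_nat M else 0) * fin_window_corr L g h a l l'
          = (if int L dvd l' - l then 1 else 0)" for l l'
  proof (cases "int M dvd l - l'")
    case True
    with assms(5) show ?thesis by (simp add: fin_corr_cond_def dvd_diff_commute)
  next
    case False
    have "int M dvd int L" using assms(3) by simp
    with False have "\<not> int L dvd l' - l" by (metis dvd_trans dvd_diff_commute)
    with False show ?thesis by simp
  qed
  have "f l = (\<Sum>n\<in>{0..<int (L div a)}. \<Sum>m\<in>{0..<int M}.
            fin_inner L f (gabor g a M m n) * gabor h a M m n l)" for l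
  proof -
    have "f l = f (l mod int L)"
      by (rule periodic_cong [OF f]) (simp add: minus_mod_eq_mult_div)
    then show ?thesis
      by (simp only: fin_frame_sum [OF \<open>M > 0\<close>] kernel sum_residue_class [OF \<open>L > 0\<close>])
  qed
  then show ?thesis by (simp add: fin_expansion_def fun_eq_iff)
qed

lemma fin_corr_cond_if_fin_expansion:
  assumes "L > 0" "M > 0" "M dvd L" and g: "g \<in> periodic_seqs L"
    and ex: "\<And>f. f \<in> periodic_seqs L \<Longrightarrow> fin_expansion L g h a M f"
  shows "fin_corr_cond L g h a M"
  unfolding fin_corr_cond_def
proof (intro allI impI)
  fix l l' :: int assume MD: "int M dvd l - l'"
  \<comment> \<open>The periodic unit impulse at \<open>l'\<close>: its expansion, evaluated at
    \<open>l\<close>, reads off a single kernel entry.\<close>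
  define f :: "int \<Rightarrow> complex" where "f = (\<lambda>x. if int L dvd x - l' then 1 else 0)"
  define K where "K = (\<lambda>x. (if int M dvd l - x then of_nat M else 0) * fin_window_corr L g h a l x)"
  have "f \<in> periodic_seqs L"
  proof -
    have "int L dvd x + int L - l' \<longleftrightarrow> int L dvd x - l'" for x
      by (metis dvd_add_left_iff dvd_refl add_diff_eq diff_add_eq)
    then show ?thesis by (simp add: f_def periodic_seqs_def)
  qed
  then have "f l = (\<Sum>x\<in>{0..<int L}. f x * K x)"
    using ex [of f] fin_frame_sum [OF \<open>M > 0\<close>, of L f g a h l]
    by (simp add: fin_expansion_def K_def fun_eq_iff)
  also have "\<dots> = (\<Sum>x\<in>{0..<int L}. K x * (if int L dvd x - l' then 1 else 0))"
    by (simp add: f_def mult.commute)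
  also have "\<dots> = K (l' mod int L)" by (rule sum_residue_class [OF \<open>L > 0\<close>])
  \<comment> \<open>The sum only sees the representative of \<open>l'\<close> in one period. Passing
    back to \<open>l'\<close> uses that \<open>M\<close> divides \<open>L\<close> and that
    \<open>g\<close> is periodic.\<close>
  also have "\<dots> = of_nat M * fin_window_corr L g h a l l'"
  proof -
    have eq: "l' - l' mod int L = int L * (l' div int L)" by (simp add: minus_mod_eq_mult_div)
    then have "int M dvd l' - l' mod int L" using assms(3) by (simp add: dvd_mult2)
    with MD have "int M dvd l - l' mod int L" by (metis dvd_add diff_add_cancel add_diff_eq)
    moreover have "g (l' mod int L - n * int a) = g (l' - n * int a)" for n
    proof (rule periodic_cong [OF g])
      have "l' mod int L - n * int a - (l' - n * int a) = - (l' - l' mod int L)" by simp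
      then show "int L dvd l' mod int L - n * int a - (l' - n * int a)"
        by (simp only: eq dvd_minus_iff dvd_triv_left)
    qed
    ultimately show ?thesis by (simp add: K_def fin_window_corr_def)
  qed
  finally show "of_nat M * fin_window_corr L g h a l l' = (if int L dvd l - l' then 1 else 0)"
    by (simp add: f_def)
qed

lemma fin_dual_windows_iff:
  assumes "L > 0" "M > 0" "M dvd L" "g \<in> periodic_seqs L" "h \<in> periodic_seqs L"
  shows "fin_dual_windows L g h a M \<longleftrightarrow> fin_corr_cond L g h a M"
  using assms fin_corr_cond_if_fin_expansion [of L M g h a] fin_corr_cond_swap [of L g h a M]
  by (auto simp: fin_dual_windows_def intro: fin_expansion_if_fin_corr_cond)

subsection \<open>Periodization\<close>

lemma infsum_eq_sum:
  assumes "finite S" "\<And>x. x \<notin> S \<Longrightarrow> f x = 0"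
  shows "infsum f UNIV = sum f S"
proof -
  have "infsum f UNIV = infsum f S"
    by (rule infsum_cong_neutral) (use assms in auto)
  with assms show ?thesis by simp
qed

lemma finite_affine_vimage:
  fixes c k :: int
  assumes "finite {x. g x \<noteq> 0}" "k \<noteq> 0"
  shows "finite {n. g (c - n * k) \<noteq> 0}"
proof -
  have "inj (\<lambda>n. c - n * k)" using assms(2) by (simp add: inj_on_def)
  from finite_vimageI [OF assms(1) this] show ?thesis by (simp add: vimage_def)
qed

text \<open>Division with remainder makes \<open>(r, k)\<close> a coordinate system on the integers.
  Finite support leaves a finite set of quotients \<open>K\<close>, so the rearrangement is one of
  finite sums.\<close>

lemma infsum_residue_classes:
  fixes u :: "int \<Rightarrow> complex" and P :: nat
  assumes "finite {n. u n \<noteq> 0}" "P > 0"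
  shows "(\<Sum>r\<in>{0..<int P}. \<Sum>\<^sub>\<infinity>k. u (r + k * int P)) = (\<Sum>\<^sub>\<infinity>n. u n)"
proof -
  define K where "K = (\<lambda>n. n div int P) ` {n. u n \<noteq> 0}"
  have "finite K" using assms by (simp add: K_def)
  define pr where "pr = (\<lambda>(r, k). r + k * int P)"
  have inj: "inj_on pr ({0..<int P} \<times> K)"
  proof (rule inj_onI)
    fix x y assume *: "x \<in> {0..<int P} \<times> K" "y \<in> {0..<int P} \<times> K" "pr x = pr y"
    obtain r k s j where xy: "x = (r, k)" "y = (s, j)" by fastforce
    with * have "(r + k * int P) mod int P = (s + j * int P) mod int P"
      "(r + k * int P) div int P = (s + j * int P) div int P" by (auto simp: pr_def)
    with * xy assms show "x = y" by simp
  qed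
  have "(\<Sum>\<^sub>\<infinity>k. u (r + k * int P)) = (\<Sum>k\<in>K. u (r + k * int P))" if "r \<in> {0..<int P}" for r
  proof (rule infsum_eq_sum [OF \<open>finite K\<close>])
    fix k assume "k \<notin> K"
    moreover have "(r + k * int P) div int P = k" using that by simp
    ultimately show "u (r + k * int P) = 0" unfolding K_def by (metis (mono_tags) image_eqI mem_Collect_eq)
  qed
  then have "(\<Sum>r\<in>{0..<int P}. \<Sum>\<^sub>\<infinity>k. u (r + k * int P))
      = (\<Sum>x\<in>{0..<int P} \<times> K. u (pr x))"
    by (simp add: sum.cartesian_product pr_def case_prod_unfold)
  also have "\<dots> = sum u (pr ` ({0..<int P} \<times> K))"
    by (simp add: sum.reindex [OF inj])
  also have "\<dots> = (\<Sum>\<^sub>\<infinity>n. u n)"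
  proof (rule infsum_eq_sum [symmetric])
    show "finite (pr ` ({0..<int P} \<times> K))" using \<open>finite K\<close> by simp
    fix n assume *: "n \<notin> pr ` ({0..<int P} \<times> K)"
    have "n = pr (n mod int P, n div int P)" by (simp add: pr_def)
    moreover have "n mod int P \<in> {0..<int P}" using assms by simp
    ultimately have "n div int P \<notin> K" using * by blast
    then show "u n = 0" by (auto simp: K_def)
  qed
  finally show ?thesis .
qed

lemma periodization_periodic: "periodization L g \<in> periodic_seqs L"
proof -
  have "(\<Sum>\<^sub>\<infinity>k. g (l + int L - k * int L)) = (\<Sum>\<^sub>\<infinity>k. g (l - k * int L))" for l
    by (rule infsum_reindex_bij_witness [of _ "\<lambda>k. k + 1" "\<lambda>k. k - 1"]) (auto simp: algebra_simps)
  then show ?thesis by (simp add: periodic_seqs_def periodization_def)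
qed

text \<open>The two periodizations play different roles: that of \<open>h\<close> extends the finite
  range of \<open>n\<close> to all integers, and that of \<open>g\<close> then supplies the sum over
  the aliases \<open>j\<close>.\<close>

lemma fin_window_corr_periodization:
  assumes g: "finite {x. g x \<noteq> 0}" and h: "finite {x. h x \<noteq> 0}"
    and "a > 0" "L > 0" "a dvd L"
  shows "fin_window_corr L (periodization L g) (periodization L h) a l l'
           = (\<Sum>\<^sub>\<infinity>j. window_corr g h a l (l' - j * int L))"
proof -
  define P where "P = L div a"
  have P: "int P * int a = int L" "P > 0" using assms by (auto simp: P_def simp flip: of_nat_mult)
  \<comment> \<open>Here \<open>g\<close> stays periodized while \<open>h\<close> is already
    unfolded.\<close>
  define u where "u = (\<lambda>n. cnj (periodization L g (l' - n * int a)) * h (l - n * int a))"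
  define N where "N = {n. h (l - n * int a) \<noteq> 0}"
  \<comment> \<open>All aliases that occur together with some relevant \<open>n\<close>; finiteness
    of \<open>N\<close> and \<open>J\<close> permits exchanging the two sums.\<close>
  define J where "J = (\<Union>n\<in>N. {j. g (l' - n * int a - j * int L) \<noteq> 0})"
  have "finite N" unfolding N_def using assms by (intro finite_affine_vimage) auto
  then have "finite J" unfolding J_def using assms by (intro finite_UN_I finite_affine_vimage) auto
  have "finite {n. u n \<noteq> 0}" by (rule finite_subset [OF _ \<open>finite N\<close>]) (auto simp: u_def N_def)
  have "fin_window_corr L (periodization L g) (periodization L h) a l l'
     = (\<Sum>r\<in>{0..<int P}. \<Sum>\<^sub>\<infinity>k. u (r + k * int P))"
    unfolding fin_window_corr_def P_def [symmetric]
  proof (rule sum.cong [OF refl])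
    fix r
    \<comment> \<open>Because \<open>P\<close> hops make up one period, shifting \<open>n\<close> by
      \<open>k * int P\<close> moves the arguments by \<open>k * int L\<close>, which the periodized
      \<open>g\<close> does not notice.\<close>
    have "u (r + k * int P) = cnj (periodization L g (l' - r * int a)) * h (l - r * int a - k * int L)"
      for k
    proof -
      have "(r + k * int P) * int a = r * int a + k * int L" by (simp add: distrib_right mult.assoc P)
      then show ?thesis
        using periodic_shift [OF periodization_periodic, of L g "l' - r * int a" "- k"]
        by (simp add: u_def diff_diff_eq)
    qed
    then show "cnj (periodization L g (l' - r * int a)) * periodization L h (l - r * int a)
        = (\<Sum>\<^sub>\<infinity>k. u (r + k * int P))"
      by (simp add: infsum_cmult_right' periodization_def [of L h])
  qed
  also have "\<dots> = (\<Sum>\<^sub>\<infinity>n. u n)"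
    by (rule infsum_residue_classes) fact+
  also have "\<dots> = (\<Sum>n\<in>N. u n)"
    by (rule infsum_eq_sum [OF \<open>finite N\<close>]) (auto simp: u_def N_def)
  also have "\<dots> = (\<Sum>n\<in>N. \<Sum>j\<in>J. cnj (g (l' - j * int L - n * int a)) * h (l - n * int a))"
  proof (rule sum.cong [OF refl])
    fix n assume "n \<in> N"
    then have "periodization L g (l' - n * int a) = (\<Sum>j\<in>J. g (l' - n * int a - j * int L))"
      unfolding periodization_def by (intro infsum_eq_sum [OF \<open>finite J\<close>]) (auto simp: J_def)
    then show "u n = (\<Sum>j\<in>J. cnj (g (l' - j * int L - n * int a)) * h (l - n * int a))"
      by (simp add: u_def sum_distrib_right diff_diff_eq add.commute)
  qed
  also have "\<dots> = (\<Sum>j\<in>J. \<Sum>n\<in>N. cnj (g (l' - j * int L - n * int a)) * h (l - n * int a))"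
    by (rule sum.swap)
  also have "\<dots> = (\<Sum>j\<in>J. window_corr g h a l (l' - j * int L))"
    unfolding window_corr_def
    by (intro sum.cong infsum_eq_sum [symmetric] \<open>finite N\<close> refl) (auto simp: N_def)
  also have "\<dots> = (\<Sum>\<^sub>\<infinity>j. window_corr g h a l (l' - j * int L))"
  proof (rule infsum_eq_sum [OF \<open>finite J\<close>, symmetric])
    fix j assume "j \<notin> J"
    then have "cnj (g (l' - j * int L - n * int a)) * h (l - n * int a) = 0" for n
      by (auto simp: J_def N_def diff_diff_eq add.commute)
    then show "window_corr g h a l (l' - j * int L) = 0"
      by (simp only: window_corr_def infsum_0_simp)
  qed
  finally show ?thesis .
qed

section \<open>Support of the correlation and transfer between the two conditions\<close>

lemma window_corr_eq_0:
  assumes "{x. g x \<noteq> 0} \<subseteq> Ig" "{x. h x \<noteq> 0} \<subseteq> Ih" "l' - l \<notin> {y - x |x y. x \<in> Ih \<and> y \<in> Ig}"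
  shows "window_corr g h a l l' = 0"
proof -
  have "cnj (g (l' - n * int a)) * h (l - n * int a) = 0" for n
  proof (rule ccontr)
    assume "cnj (g (l' - n * int a)) * h (l - n * int a) \<noteq> 0"
    with assms(1,2) have "l' - n * int a \<in> Ig" "l - n * int a \<in> Ih" by auto
    moreover have "l' - l = (l' - n * int a) - (l - n * int a)" by simp
    ultimately show False using assms(3) by blast
  qed
  then show ?thesis by (simp only: window_corr_def infsum_0_simp)
qed

lemma int_interval_diff_less_card:
  assumes "int_interval I" "finite I" "x \<in> I" "y \<in> I"
  shows "y - x < int (card I)"
proof -
  have "{x..y} \<subseteq> I" using assms by (simp add: int_interval_def)
  then have "card {x..y} \<le> card I" using assms(2) by (rule card_mono [rotated])
  \<comment> \<open>For \<open>x \<le> y\<close> the integer interval has \<open>y - x + 1\<close>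
    elements, whence the strict bound; for \<open>y < x\<close> the difference is negative.\<close>
  then show ?thesis using assms card_gt_0_iff by fastforce
qed

text \<open>The quantity \<open>d - e\<close> splits into one difference within each interval, and
  each is at most the length minus one; this accounts for the 2.\<close>

lemma int_interval_differences:
  assumes "int_interval Ig" "finite Ig" "int_interval Ih" "finite Ih"
    and "d \<in> {y - x |x y. x \<in> Ih \<and> y \<in> Ig}" "e \<in> {y - x |x y. x \<in> Ih \<and> y \<in> Ig}"
  shows "d - e \<le> int (card Ig + card Ih) - 2"
proof -
  from assms(5,6) obtain x y x' y' where
    "x \<in> Ih" "y \<in> Ig" "d = y - x" "x' \<in> Ih" "y' \<in> Ig" "e = y' - x'" by blast
  with int_interval_diff_less_card [of Ig y' y] int_interval_diff_less_card [of Ih x x']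
  show ?thesis using assms(1-4) by simp
qed

text \<open>Since \<open>M\<close> divides \<open>L\<close>, the condition evaluates every alias
  term. Exactly one alias of \<open>l'\<close> equals \<open>l\<close> if they agree modulo
  \<open>L\<close>, and none otherwise.\<close>

lemma fin_corr_cond_if_corr_cond:
  assumes "finite {x. g x \<noteq> 0}" "finite {x. h x \<noteq> 0}" "a > 0" "L > 0" "a dvd L" "M dvd L"
    and "corr_cond g h a M"
  shows "fin_corr_cond L (periodization L g) (periodization L h) a M"
  unfolding fin_corr_cond_def
proof (intro allI impI)
  fix l l' :: int assume MD: "int M dvd l - l'"
  have "int M dvd int L" using assms(6) by simp
  have "of_nat M * fin_window_corr L (periodization L g) (periodization L h) a l l'
      = (\<Sum>\<^sub>\<infinity>j. of_nat M * window_corr g h a l (l' - j * int L))"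
    by (simp add: fin_window_corr_periodization [OF assms(1-5)] infsum_cmult_right')
  also have "\<dots> = (\<Sum>\<^sub>\<infinity>j. if l = l' - j * int L then 1 else 0)"
  proof (rule infsum_cong)
    fix j
    have "l - (l' - j * int L) = (l - l') + j * int L" by simp
    then have "int M dvd l - (l' - j * int L)"
      using MD \<open>int M dvd int L\<close> by (metis dvd_add dvd_mult)
    with assms(7) show "of_nat M * window_corr g h a l (l' - j * int L)
        = (if l = l' - j * int L then 1 else 0)"
      by (simp add: corr_cond_def)
  qed
  also have "\<dots> = (if int L dvd l - l' then 1 else 0)"
  proof (cases "int L dvd l - l'")
    case True
    then obtain c where "l - l' = int L * c" ..
    then have "l = l' - j * int L \<longleftrightarrow> - int L * j = int L * c" for j by (auto simp: algebra_simps)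
    also have "- int L * j = int L * c \<longleftrightarrow> j = - c" for j
      using assms(4) by (metis equation_minus_iff mult_cancel_left mult_minus_left mult_minus_right of_nat_0_eq_iff less_irrefl)
    finally have "(\<Sum>\<^sub>\<infinity>j. if l = l' - j * int L then 1 else 0 :: complex) = (\<Sum>j\<in>{- c}. 1)"
      by (simp only:) (subst infsum_eq_sum [of "{- c}"], auto)
    with True show ?thesis by simp
  next
    case False
    then have "l \<noteq> l' - j * int L" for j by auto
    with False show ?thesis by simp
  qed
  finally show "of_nat M * fin_window_corr L (periodization L g) (periodization L h) a l l'
      = (if int L dvd l - l' then 1 else 0)" .
qed

lemma corr_cond_if_fin_corr_cond:
  assumes gI: "{x. g x \<noteq> 0} \<subseteq> Ig" "int_interval Ig" "finite Ig"
    and hI: "{x. h x \<noteq> 0} \<subseteq> Ih" "int_interval Ih" "finite Ih"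
    and "Ig \<inter> Ih \<noteq> {}" "a > 0" "a dvd L" "L > card Ig + card Ih"
    and fc: "fin_corr_cond L (periodization L g) (periodization L h) a M"
  shows "corr_cond g h a M"
  unfolding corr_cond_def
proof (intro allI impI)
  fix l l' :: int assume MD: "int M dvd l - l'"
  define D where "D = {y - x |x y. x \<in> Ih \<and> y \<in> Ig}"
  have "0 \<in> D" using assms(7) by (force simp: D_def)
  have D: "d - e \<le> int (card Ig + card Ih) - 2" if "d \<in> D" "e \<in> D" for d e
    using int_interval_differences [OF gI(2,3) hI(2,3)] that by (simp add: D_def)
  \<comment> \<open>Two members of \<open>D\<close> differ by less than \<open>L\<close>, so
    congruence modulo \<open>L\<close> is equality. This excludes the aliases with
    \<open>j \<noteq> 0\<close>.\<close>
  have eqD: "d = e" if "d \<in> D" "e \<in> D" "int L dvd d - e" for d e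
  proof -
    have "\<bar>d - e\<bar> < int L" using D [of d e] D [of e d] that assms(10) by linarith
    with that(3) show ?thesis using zdvd_imp_le [of "int L" "\<bar>d - e\<bar>"] by force
  qed
  show "of_nat M * window_corr g h a l l' = (if l = l' then 1 else 0)"
  proof (cases "l' - l \<in> D")
    case True
    have fin: "finite {x. g x \<noteq> 0}" "finite {x. h x \<noteq> 0}"
      using gI hI finite_subset by auto
    have "window_corr g h a l (l' - j * int L) = 0" if "j \<noteq> 0" for j
    proof (rule window_corr_eq_0 [OF gI(1) hI(1)], fold D_def, rule notI)
      assume "l' - j * int L - l \<in> D"
      then have "l' - j * int L - l = l' - l" by (rule eqD [OF _ True]) simp
      with that assms(10) show False by simp
    qed
    then have "(\<Sum>\<^sub>\<infinity>j. window_corr g h a l (l' - j * int L))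
        = (\<Sum>j\<in>{0}. window_corr g h a l (l' - j * int L))"
      by (intro infsum_eq_sum) auto
    then have eq: "fin_window_corr L (periodization L g) (periodization L h) a l l' = window_corr g h a l l'"
      using fin_window_corr_periodization [OF fin assms(8) _ assms(9)] assms(10) by simp
    from fc MD have "of_nat M * window_corr g h a l l' = (if int L dvd l - l' then 1 else 0)"
      unfolding fin_corr_cond_def eq [symmetric] by blast
    \<comment> \<open>Comparing \<open>l' - l\<close> with the member 0 of \<open>D\<close> turns
      the periodic Kronecker delta into the ordinary one.\<close>
    moreover have "int L dvd l - l' \<longleftrightarrow> l = l'"
      using eqD [OF True \<open>0 \<in> D\<close>] by (auto simp: dvd_diff_commute)
    ultimately show ?thesis by simp
  next
    case False
    \<comment> \<open>Outside \<open>D\<close> the correlation vanishes, and the prescribed value is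
      0 as well because 0 lies in \<open>D\<close>.\<close>
    with \<open>0 \<in> D\<close> have "l \<noteq> l'" by auto
    with False show ?thesis using window_corr_eq_0 [OF gI(1) hI(1)] by (simp add: D_def)
  qed
qed

subsection \<open>Duality for square-summable sequences\<close>

lemma square_summable_add:
  fixes u v :: "'a \<Rightarrow> real"
  assumes "(\<lambda>l. (u l)\<^sup>2) summable_on A" "(\<lambda>l. (v l)\<^sup>2) summable_on A"
  shows "(\<lambda>l. (u l + v l)\<^sup>2) summable_on A"
proof (rule summable_on_comparison_test)
  show "(\<lambda>l. 2 * (u l)\<^sup>2 + 2 * (v l)\<^sup>2) summable_on A"
    using assms by (intro summable_on_add summable_on_cmult_right)
  show "(u l + v l)\<^sup>2 \<le> 2 * (u l)\<^sup>2 + 2 * (v l)\<^sup>2" for l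
    using zero_le_power2 [of "u l - v l"] by (simp add: power2_eq_square algebra_simps)
qed simp

lemma square_summable_sum:
  fixes u :: "'b \<Rightarrow> 'a \<Rightarrow> real"
  assumes "\<And>d. d \<in> D \<Longrightarrow> (\<lambda>l. (u d l)\<^sup>2) summable_on A"
  shows "(\<lambda>l. (\<Sum>d\<in>D. u d l)\<^sup>2) summable_on A"
  using assms by (induction D rule: infinite_finite_induct) (auto intro: square_summable_add)

text \<open>Dominated convergence along an arbitrary filter: off a finite set the majorant is small, and
  on that set the sequences eventually vanish.\<close>

lemma ell2_norm_tendsto_0:
  assumes G: "(\<lambda>l. (G l :: real)\<^sup>2) summable_on UNIV"
    and le: "\<And>N l. cmod (F N l) \<le> G l"
    and ev: "\<And>l. \<forall>\<^sub>F N in X. F N l = 0"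
  shows "((\<lambda>N. ell2_norm (F N)) \<longlongrightarrow> 0) X"
proof -
  have Fs: "(\<lambda>l. (cmod (F N l))\<^sup>2) summable_on UNIV" for N
    by (rule summable_on_comparison_test [OF G]) (auto intro: power_mono le)
  have "((\<lambda>N. \<Sum>\<^sub>\<infinity>l. (cmod (F N l))\<^sup>2) \<longlongrightarrow> 0) X"
  proof (rule tendstoI)
    \<comment> \<open>The finite approximation gives a non-strict bound; taking \<open>e / 2\<close>
      leaves a tail strictly below \<open>e\<close>.\<close>
    fix e :: real assume "e > 0"
    then obtain A where A: "finite A"
      "dist (\<Sum>l\<in>A. (G l)\<^sup>2) (\<Sum>\<^sub>\<infinity>l. (G l)\<^sup>2) \<le> e / 2"
      using infsum_finite_approximation [OF G, of "e / 2"] by auto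
    have GA: "(\<lambda>l. (G l)\<^sup>2) summable_on (UNIV - A)"
      using G A(1) by (intro summable_on_Diff) auto
    have "(\<Sum>\<^sub>\<infinity>l\<in>UNIV - A. (G l)\<^sup>2) = (\<Sum>\<^sub>\<infinity>l. (G l)\<^sup>2) - (\<Sum>l\<in>A. (G l)\<^sup>2)"
      using G A(1) by (subst infsum_Diff) auto
    with A(2) \<open>e > 0\<close> have small: "(\<Sum>\<^sub>\<infinity>l\<in>UNIV - A. (G l)\<^sup>2) < e"
      unfolding dist_real_def by linarith
    have "\<forall>\<^sub>F N in X. \<forall>l\<in>A. F N l = 0"
      using A(1) ev by (simp add: eventually_ball_finite)
    then show "\<forall>\<^sub>F N in X. dist (\<Sum>\<^sub>\<infinity>l. (cmod (F N l))\<^sup>2) 0 < e"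
    proof eventually_elim
      case (elim N)
      have "(\<Sum>\<^sub>\<infinity>l. (cmod (F N l))\<^sup>2) \<le> (\<Sum>\<^sub>\<infinity>l\<in>UNIV - A. (G l)\<^sup>2)"
        by (rule infsum_mono_neutral [OF Fs GA]) (auto intro: power_mono le simp: elim)
      moreover have "(\<Sum>\<^sub>\<infinity>l. (cmod (F N l))\<^sup>2) \<ge> 0" by (rule infsum_nonneg) simp
      ultimately show ?case using small by (simp add: dist_real_def)
    qed
  qed
  from tendsto_real_sqrt [OF this] show ?thesis by (simp add: ell2_norm_def)
qed

text \<open>Lets convergence in norm be read at each single index.\<close>

lemma cmod_le_ell2_norm:
  assumes "f \<in> ell2"
  shows "cmod (f l) \<le> ell2_norm f"
proof -
  have "(cmod (f l))\<^sup>2 \<le> (\<Sum>\<^sub>\<infinity>l. (cmod (f l))\<^sup>2)"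
    using finite_sum_le_infsum [of "\<lambda>l. (cmod (f l))\<^sup>2" UNIV "{l}"] assms by (simp add: ell2_def)
  then show ?thesis by (simp add: ell2_norm_def real_le_rsqrt)
qed

text \<open>A nonzero value of \<open>h\<close> at \<open>l - n * int a\<close> places that point in
  \<open>Ih\<close>. The inner product then involves only \<open>l'\<close> with
  \<open>l' - n * int a\<close> in \<open>Ig\<close>, so \<open>l' - l\<close> lies in the finite
  set \<open>D\<close>, which depends neither on \<open>n\<close> nor on \<open>l\<close>.\<close>

lemma ell2_frame_sum:
  assumes "M > 0" and gI: "{x. g x \<noteq> 0} \<subseteq> Ig" "finite Ig" and hI: "{x. h x \<noteq> 0} \<subseteq> Ih" "finite Ih"
  defines "D \<equiv> {y - x |x y. x \<in> Ih \<and> y \<in> Ig}"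
  shows "(\<Sum>n\<in>N. \<Sum>m\<in>{0..<int M}. ell2_inner f (gabor g a M m n) * gabor h a M m n l)
     = (\<Sum>d\<in>D. f (l + d) * ((if int M dvd d then of_nat M else 0) *
          (\<Sum>n\<in>N. cnj (g (l + d - n * int a)) * h (l - n * int a))))"
proof -
  have "D = (\<lambda>(x, y). y - x) ` (Ih \<times> Ig)" by (auto simp: D_def)
  then have "finite D" using gI hI by simp
  have "(\<Sum>m\<in>{0..<int M}. ell2_inner f (gabor g a M m n) * gabor h a M m n l)
     = (\<Sum>d\<in>D. f (l + d) * ((if int M dvd d then of_nat M else 0) *
          (cnj (g (l + d - n * int a)) * h (l - n * int a))))" for n
  proof (cases "h (l - n * int a) = 0")
    case True
    then show ?thesis by (simp add: gabor_def modulate_def translate_def)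
  next
    case False
    have inner: "ell2_inner f (gabor g a M m n) = (\<Sum>d\<in>D. f (l + d) * cnj (gabor g a M m n (l + d)))" for m
    proof -
      have "ell2_inner f (gabor g a M m n) = (\<Sum>l'\<in>(+) l ` D. f l' * cnj (gabor g a M m n l'))"
        unfolding ell2_inner_def
      proof (rule infsum_eq_sum)
        show "finite ((+) l ` D)" using \<open>finite D\<close> by simp
        fix l' assume l': "l' \<notin> (+) l ` D"
        have "g (l' - n * int a) = 0"
        proof (rule ccontr)
          assume "g (l' - n * int a) \<noteq> 0"
          with False gI hI have "l' - n * int a \<in> Ig" "l - n * int a \<in> Ih" by auto
          then have "(l' - n * int a) - (l - n * int a) \<in> D" unfolding D_def by blast
          then have "l' - l \<in> D" by simp
          with l' show False by (metis add_diff_cancel_left' diff_add_cancel add.commute image_eqI)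
        qed
        then show "f l' * cnj (gabor g a M m n l') = 0"
          by (simp add: gabor_def modulate_def translate_def)
      qed
      then show ?thesis by (simp add: sum.reindex)
    qed
    have "(\<Sum>m\<in>{0..<int M}. ell2_inner f (gabor g a M m n) * gabor h a M m n l)
       = (\<Sum>m\<in>{0..<int M}. \<Sum>d\<in>D. f (l + d) * (cnj (gabor g a M m n (l + d)) * gabor h a M m n l))"
      by (simp add: inner sum_distrib_right mult.assoc)
    also have "\<dots> = (\<Sum>d\<in>D. f (l + d) *
        (\<Sum>m\<in>{0..<int M}. cnj (gabor g a M m n (l + d)) * gabor h a M m n l))"
      by (subst sum.swap) (simp add: sum_distrib_left)
    also have "\<dots> = (\<Sum>d\<in>D. f (l + d) * ((if int M dvd d then of_nat M else 0) *
          (cnj (g (l + d - n * int a)) * h (l - n * int a))))"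
      by (simp only: sum_gabor_product [OF \<open>M > 0\<close>]) simp
    finally show ?thesis .
  qed
  then have "(\<Sum>n\<in>N. \<Sum>m\<in>{0..<int M}. ell2_inner f (gabor g a M m n) * gabor h a M m n l)
     = (\<Sum>n\<in>N. \<Sum>d\<in>D. f (l + d) * ((if int M dvd d then of_nat M else 0) *
          (cnj (g (l + d - n * int a)) * h (l - n * int a))))" by simp
  also have "\<dots> = (\<Sum>d\<in>D. f (l + d) * ((if int M dvd d then of_nat M else 0) *
          (\<Sum>n\<in>N. cnj (g (l + d - n * int a)) * h (l - n * int a))))"
    by (subst sum.swap) (simp only: sum_distrib_left)
  finally show ?thesis .
qed

text \<open>Distinct \<open>n\<close> give distinct points \<open>l - n * int a\<close>, so a sum
  over \<open>Ih\<close> dominates. The bound is uniform in \<open>N\<close> and \<open>l\<close>,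
  as a square-summable majorant requires.\<close>

lemma frame_kernel_bound:
  assumes "a > 0" and hI: "{x. h x \<noteq> 0} \<subseteq> Ih" "finite Ih"
  shows "cmod (\<Sum>n\<in>N. cnj (g (l + d - n * int a)) * h (l - n * int a))
           \<le> (\<Sum>x\<in>Ih. cmod (g (x + d)) * cmod (h x))"
proof (cases "finite N")
  case True
  define N' where "N' = {n\<in>N. l - n * int a \<in> Ih}"
  have inj: "inj_on (\<lambda>n. l - n * int a) N'" using assms by (simp add: inj_on_def)
  have "(\<Sum>n\<in>N. cnj (g (l + d - n * int a)) * h (l - n * int a))
      = (\<Sum>n\<in>N'. cnj (g (l + d - n * int a)) * h (l - n * int a))"
    by (rule sum.mono_neutral_right [OF True]) (use hI in \<open>auto simp: N'_def\<close>)
  then have "cmod (\<Sum>n\<in>N. cnj (g (l + d - n * int a)) * h (l - n * int a))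
      \<le> (\<Sum>n\<in>N'. cmod (g (l - n * int a + d)) * cmod (h (l - n * int a)))"
    by (auto intro!: order.trans [OF norm_sum] simp: norm_mult algebra_simps)
  also have "\<dots> = (\<Sum>x\<in>(\<lambda>n. l - n * int a) ` N'. cmod (g (x + d)) * cmod (h x))"
    by (simp add: sum.reindex [OF inj])
  also have "\<dots> \<le> (\<Sum>x\<in>Ih. cmod (g (x + d)) * cmod (h x))"
    by (rule sum_mono2 [OF hI(2)]) (auto simp: N'_def)
  finally show ?thesis .
\<comment> \<open>For infinite \<open>N\<close> the sum is 0 by convention.\<close>
qed (simp add: sum_nonneg)

text \<open>At each index the error of the partial sums is eventually constant in \<open>N\<close>.
  Norm convergence forces this constant to be 0; conversely, if it is 0 everywhere, dominated
  convergence gives norm convergence.\<close>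

lemma ell2_expansion_iff:
  assumes "a > 0" "M > 0" and gI: "{x. g x \<noteq> 0} \<subseteq> Ig" "finite Ig"
    and hI: "{x. h x \<noteq> 0} \<subseteq> Ih" "finite Ih" and f: "f \<in> ell2"
  defines "D \<equiv> {y - x |x y. x \<in> Ih \<and> y \<in> Ig}"
  shows "ell2_expansion g h a M f \<longleftrightarrow>
    (\<forall>l. f l = (\<Sum>d\<in>D. f (l + d) *
       ((if int M dvd d then of_nat M else 0) * window_corr g h a l (l + d))))"
    (is "_ \<longleftrightarrow> (\<forall>l. f l = ?S l)")
proof -
  define F where "F = (\<lambda>N l. f l -
    (\<Sum>n\<in>N. \<Sum>m\<in>{0..<int M}. ell2_inner f (gabor g a M m n) * gabor h a M m n l))"
  define C where "C = (\<lambda>d. real M * (\<Sum>x\<in>Ih. cmod (g (x + d)) * cmod (h x)))"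
  \<comment> \<open>A finite combination of shifts of \<open>cmod (f l)\<close>, hence
    square-summable; \<open>C\<close> bounds the kernel coefficients uniformly.\<close>
  define G where "G = (\<lambda>l. cmod (f l) + (\<Sum>d\<in>D. C d * cmod (f (l + d))))"
  have F: "F N l = f l - (\<Sum>d\<in>D. f (l + d) * ((if int M dvd d then of_nat M else 0) *
          (\<Sum>n\<in>N. cnj (g (l + d - n * int a)) * h (l - n * int a))))" for N l
    unfolding F_def D_def ell2_frame_sum [OF assms(2) gI hI] ..
  have ev: "\<forall>\<^sub>F N in finite_subsets_at_top UNIV. F N l = f l - ?S l" for l
  proof -
    \<comment> \<open>Once \<open>N\<close> contains \<open>N0\<close>, further \<open>n\<close>
      contribute nothing at index \<open>l\<close>.\<close>
    define N0 where "N0 = {n. h (l - n * int a) \<noteq> 0}"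
    have "finite N0"
      unfolding N0_def using assms finite_subset by (intro finite_affine_vimage) auto
    show ?thesis unfolding eventually_finite_subsets_at_top
    proof (intro exI [of _ N0] conjI allI impI)
      fix N assume N: "finite N \<and> N0 \<subseteq> N \<and> N \<subseteq> UNIV"
      have "(\<Sum>n\<in>N. cnj (g (l + d - n * int a)) * h (l - n * int a)) = window_corr g h a l (l + d)" for d
        unfolding window_corr_def
        by (rule infsum_eq_sum [symmetric]) (use N in \<open>auto simp: N0_def\<close>)
      then show "F N l = f l - ?S l" by (simp add: F)
    qed (use \<open>finite N0\<close> in auto)
  qed
  have G: "(\<lambda>l. (G l)\<^sup>2) summable_on UNIV"
    unfolding G_def
  proof (intro square_summable_add square_summable_sum)
    show f2: "(\<lambda>l. (cmod (f l))\<^sup>2) summable_on UNIV" using f by (simp add: ell2_def)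
    fix d
    have "(\<lambda>l. (cmod (f (l + d)))\<^sup>2) summable_on UNIV"
      by (subst summable_on_reindex_bij_witness [of UNIV "\<lambda>l. l - d" "\<lambda>l. l + d" UNIV "\<lambda>l. (cmod (f l))\<^sup>2"])
        (use f2 in auto)
    then show "(\<lambda>l. (C d * cmod (f (l + d)))\<^sup>2) summable_on UNIV"
      by (simp add: power_mult_distrib summable_on_cmult_right)
  qed
  have le: "cmod (F N l) \<le> G l" for N l
  proof -
    have C: "cmod ((if int M dvd d then of_nat M else 0) *
        (\<Sum>n\<in>N. cnj (g (l + d - n * int a)) * h (l - n * int a))) \<le> C d" for d
      using frame_kernel_bound [OF assms(1) hI, of g l d N]
      by (auto simp: norm_mult C_def mult_left_mono intro!: mult_nonneg_nonneg sum_nonneg)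
    show ?thesis unfolding F G_def
      by (intro order.trans [OF norm_triangle_ineq4] add_left_mono order.trans [OF norm_sum] sum_mono)
        (use C in \<open>simp add: norm_mult [of "f _"] mult.commute [of "C _"] mult_left_mono\<close>)
  qed
  show ?thesis
  proof
    assume "ell2_expansion g h a M f"
    then have lim: "((\<lambda>N. ell2_norm (F N)) \<longlongrightarrow> 0) (finite_subsets_at_top UNIV)"
      by (simp add: ell2_expansion_def F_def)
    show "\<forall>l. f l = ?S l"
    proof
      fix l
      have mem: "F N \<in> ell2" for N
        unfolding ell2_def mem_Collect_eq
        by (rule summable_on_comparison_test [OF G]) (auto intro: power_mono le)
      have "((\<lambda>N. F N l) \<longlongrightarrow> 0) (finite_subsets_at_top UNIV)"
        by (rule Lim_null_comparison [OF _ lim]) (simp add: cmod_le_ell2_norm mem)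
      moreover have "((\<lambda>N. F N l) \<longlongrightarrow> f l - ?S l) (finite_subsets_at_top UNIV)"
        by (rule tendsto_eventually) (rule ev)
      ultimately have "f l - ?S l = 0"
        by (rule tendsto_unique [OF finite_subsets_at_top_neq_bot, rotated])
      then show "f l = ?S l" by simp
    qed
  next
    assume "\<forall>l. f l = ?S l"
    then have "f l - ?S l = 0" for l unfolding right_minus_eq by (rule spec)
    note ev [unfolded this]
    from ell2_norm_tendsto_0 [OF G le this] show "ell2_expansion g h a M f"
      by (simp add: ell2_expansion_def F_def)
  qed
qed

section \<open>Expansions on the integers and the correlation condition\<close>

lemma ell2_expansion_if_corr_cond:
  assumes "a > 0" "M > 0" and gI: "{x. g x \<noteq> 0} \<subseteq> Ig" "finite Ig"
    and hI: "{x. h x \<noteq> 0} \<subseteq> Ih" "finite Ih" and "Ig \<inter> Ih \<noteq> {}" and f: "f \<in> ell2"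
    and c: "corr_cond g h a M"
  shows "ell2_expansion g h a M f"
proof (subst ell2_expansion_iff [OF assms(1,2) gI hI f], intro allI)
  fix l
  define D where "D = {y - x |x y. x \<in> Ih \<and> y \<in> Ig}"
  have "D = (\<lambda>(x, y). y - x) ` (Ih \<times> Ig)" by (auto simp: D_def)
  then have "finite D" using gI hI by simp
  \<comment> \<open>The intervals meet, so the diagonal term \<open>f l\<close> occurs in the sum
    over \<open>D\<close>.\<close>
  have "0 \<in> D" using assms(7) by (force simp: D_def)
  have "(if int M dvd d then of_nat M else 0) * window_corr g h a l (l + d) = (if d = 0 then 1 else 0)"
    for d
  proof -
    from c have "int M dvd l - (l + d) \<Longrightarrow>
        of_nat M * window_corr g h a l (l + d) = (if l = l + d then 1 else 0)"
      unfolding corr_cond_def by blast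
    then show ?thesis by auto
  qed
  then have "(\<Sum>d\<in>D. f (l + d) *
       ((if int M dvd d then of_nat M else 0) * window_corr g h a l (l + d)))
     = (\<Sum>d\<in>D. if d = 0 then f l else 0)"
    by (intro sum.cong) auto
  also have "\<dots> = f l" using \<open>finite D\<close> \<open>0 \<in> D\<close> by simp
  finally show "f l = (\<Sum>d\<in>{y - x |x y. x \<in> Ih \<and> y \<in> Ig}. f (l + d) *
       ((if int M dvd d then of_nat M else 0) * window_corr g h a l (l + d)))"
    by (simp add: D_def)
qed

lemma corr_cond_if_ell2_expansion:
  assumes "a > 0" "M > 0" and gI: "{x. g x \<noteq> 0} \<subseteq> Ig" "finite Ig"
    and hI: "{x. h x \<noteq> 0} \<subseteq> Ih" "finite Ih" and "Ig \<inter> Ih \<noteq> {}"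
    and ex: "\<And>f. f \<in> ell2 \<Longrightarrow> ell2_expansion g h a M f"
  shows "corr_cond g h a M"
  unfolding corr_cond_def
proof (intro allI impI)
  fix l l' :: int assume MD: "int M dvd l - l'"
  define D where "D = {y - x |x y. x \<in> Ih \<and> y \<in> Ig}"
  have "D = (\<lambda>(x, y). y - x) ` (Ih \<times> Ig)" by (auto simp: D_def)
  then have "finite D" using gI hI by simp
  have "0 \<in> D" using assms(7) by (force simp: D_def)
  show "of_nat M * window_corr g h a l l' = (if l = l' then 1 else 0)"
  proof (cases "l' - l \<in> D")
    case True
    \<comment> \<open>The unit impulse at \<open>l'\<close> isolates the kernel entry with offset
      \<open>l' - l\<close>, provided this offset lies in \<open>D\<close>.\<close>
    define f :: "int \<Rightarrow> complex" where "f = (\<lambda>x. if x = l' then 1 else 0)"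
    have "f \<in> ell2"
      unfolding ell2_def mem_Collect_eq by (rule finite_nonzero_values_imp_summable_on) (simp add: f_def)
    from ex [OF this] ell2_expansion_iff [OF assms(1,2) gI hI this]
    have "f l = (\<Sum>d\<in>D. f (l + d) * ((if int M dvd d then of_nat M else 0) * window_corr g h a l (l + d)))"
      unfolding D_def by blast
    also have "\<dots> = (\<Sum>d\<in>D. if d = l' - l then of_nat M * window_corr g h a l l' else 0)"
    proof (rule sum.cong [OF refl])
      fix d
      have "int M dvd l' - l" using MD by (simp add: dvd_diff_commute)
      then show "f (l + d) * ((if int M dvd d then of_nat M else 0) * window_corr g h a l (l + d))
          = (if d = l' - l then of_nat M * window_corr g h a l l' else 0)"
        by (auto simp: f_def)
    qed
    also have "\<dots> = of_nat M * window_corr g h a l l'" using \<open>finite D\<close> True by simp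
    finally show ?thesis by (simp add: f_def)
  next
    case False
    with \<open>0 \<in> D\<close> have "l \<noteq> l'" by auto
    with False show ?thesis using window_corr_eq_0 [OF gI(1) hI(1)] by (simp add: D_def)
  qed
qed

lemma ell2_dual_windows_iff:
  assumes "a > 0" "M > 0" and gI: "{x. g x \<noteq> 0} \<subseteq> Ig" "finite Ig"
    and hI: "{x. h x \<noteq> 0} \<subseteq> Ih" "finite Ih" and ne: "Ig \<inter> Ih \<noteq> {}"
    and "g \<in> ell2" "h \<in> ell2"
  shows "ell2_dual_windows g h a M \<longleftrightarrow> corr_cond g h a M"
proof
  assume "ell2_dual_windows g h a M"
  then show "corr_cond g h a M"
    by (intro corr_cond_if_ell2_expansion [OF assms(1,2) gI hI ne]) (simp add: ell2_dual_windows_def)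
next
  assume c: "corr_cond g h a M"
  have "Ih \<inter> Ig \<noteq> {}" using ne by blast
  note gh = ell2_expansion_if_corr_cond [OF assms(1,2) gI hI ne _ c]
    and hg = ell2_expansion_if_corr_cond [OF assms(1,2) hI gI this _ corr_cond_swap [OF c]]
  show "ell2_dual_windows g h a M"
    using assms gh hg by (simp add: ell2_dual_windows_def)
qed

subsection \<open>Wexler-Raz equations\<close>

text \<open>The shifts \<open>n\<close> for which the intervals meet form a set \<open>S\<close>
  with \<open>(Max S - Min S) * int M\<close> at most the total length minus 2. Each such
  \<open>n\<close> accounts for \<open>a\<close> equations.\<close>

lemma nontrivial_wexler_raz_count:
  fixes a :: nat
  assumes "M > 0" and gI: "int_interval Ig" "finite Ig" and hI: "int_interval Ih" "finite Ih"
    and ne: "Ig \<inter> Ih \<noteq> {}"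
  defines "E \<equiv> {(m, n). m \<in> {0..<int a} \<and> \<not> wexler_raz_trivial Ig Ih M m n}"
  shows "finite E" and "int (card E) \<le> int a * \<lceil>real (card Ig + card Ih) / real M\<rceil>"
proof -
  define S where "S = {n. \<exists>x\<in>Ih. \<exists>y\<in>Ig. x = y + n * int M}"
  define B where "B = int (card Ig + card Ih)"
  have "0 \<in> S" using ne by (auto simp: S_def)
  have diff: "(n' - n) * int M \<le> B - 2" if "n \<in> S" "n' \<in> S" for n n'
  proof -
    from that obtain x y x' y' where
      *: "x \<in> Ih" "y \<in> Ig" "x = y + n * int M" "x' \<in> Ih" "y' \<in> Ig" "x' = y' + n' * int M"
      by (auto simp: S_def)
    then have "y - x \<in> {y - x |x y. x \<in> Ih \<and> y \<in> Ig}" "y' - x' \<in> {y - x |x y. x \<in> Ih \<and> y \<in> Ig}"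
      by blast+
    from int_interval_differences [OF gI hI this] * show ?thesis by (simp add: B_def algebra_simps)
  qed
  \<comment> \<open>A crude bound by comparison with the shift 0; it only secures finiteness, so
    that \<open>Min S\<close> and \<open>Max S\<close> make sense.\<close>
  have "S \<subseteq> {- B..B}"
  proof
    fix n assume "n \<in> S"
    with diff [OF this \<open>0 \<in> S\<close>] diff [OF \<open>0 \<in> S\<close> this] have "\<bar>n\<bar> * int M \<le> B"
      by (auto simp: abs_if)
    moreover have "\<bar>n\<bar> * 1 \<le> \<bar>n\<bar> * int M" using assms(1) by (intro mult_left_mono) auto
    ultimately show "n \<in> {- B..B}" by auto
  qed
  then have "finite S" by (rule finite_subset) simp
  have "S \<noteq> {}" using \<open>0 \<in> S\<close> by blast
  \<comment> \<open>The equations with \<open>n = 0\<close> are nontrivial by definition, which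
    agrees with 0 belonging to \<open>S\<close>.\<close>
  have E: "E = {0..<int a} \<times> S"
    using ne by (auto simp: E_def S_def wexler_raz_trivial_def)
  with \<open>finite S\<close> show "finite E" by simp
  have "S \<subseteq> {Min S..Max S}" using \<open>finite S\<close> by auto
  then have "card S \<le> card {Min S..Max S}" by (rule card_mono [rotated]) simp
  moreover have "Min S \<le> Max S" using \<open>finite S\<close> \<open>S \<noteq> {}\<close> by simp
  ultimately have "int (card S) - 1 \<le> Max S - Min S" by simp
  then have "(int (card S) - 1) * int M \<le> (Max S - Min S) * int M" by (intro mult_right_mono) auto
  also have "\<dots> \<le> B - 2" using \<open>finite S\<close> \<open>S \<noteq> {}\<close> by (intro diff) auto
  finally have "(int (card S) - 1) * int M < B" by simp
  then have "real_of_int (int (card S) - 1) * real M < real_of_int B"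
    by (metis of_int_less_iff of_int_mult of_int_of_nat_eq)
  then have "real_of_int (int (card S) - 1) < real (card Ig + card Ih) / real M"
    using assms(1) by (simp add: B_def pos_less_divide_eq)
  \<comment> \<open>An integer whose predecessor is strictly below a real number is at most the
    ceiling of that number.\<close>
  then have "int (card S) \<le> \<lceil>real (card Ig + card Ih) / real M\<rceil>" by linarith
  then show "int (card E) \<le> int a * \<lceil>real (card Ig + card Ih) / real M\<rceil>"
    by (simp add: E card_cartesian_product mult_left_mono)
qed

text \<open>Justifies the word trivial: an index with nonzero product would lie in both
  \<open>Ih\<close> and the shifted \<open>Ig\<close>.\<close>

lemma trivial_wexler_raz_holds:
  assumes "{x. g x \<noteq> 0} \<subseteq> Ig" "{x. h x \<noteq> 0} \<subseteq> Ih" "wexler_raz_trivial Ig Ih M m n"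
  shows "wexler_raz_lhs g h a M m n = 0" and "wexler_raz_rhs m n = 0"
proof -
  have "h l * cnj (g (l - n * int M) * c) = 0" for l c
  proof (rule ccontr)
    assume "h l * cnj (g (l - n * int M) * c) \<noteq> 0"
    with assms(1,2) have "l \<in> Ih" "l - n * int M \<in> Ig" by auto
    then have "l \<in> Ih \<inter> (\<lambda>l. l + n * int M) ` Ig" by (auto intro: image_eqI [of _ _ "l - n * int M"])
    with assms(3) show False by (simp add: wexler_raz_trivial_def)
  qed
  then show "wexler_raz_lhs g h a M m n = 0" by (simp only: wexler_raz_lhs_def ell2_inner_def) simp
  show "wexler_raz_rhs m n = 0"
    using assms(3) by (simp add: wexler_raz_trivial_def wexler_raz_rhs_def kdelta_def)
qed

section \<open>Assembling the theorem\<close>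

lemma supp_superset: "{x. f x \<noteq> 0} \<subseteq> supp f"
  unfolding supp_def by (rule hull_subset)

theorem lemma1:
  fixes a M Lg Lh :: nat and Ig Ih :: "int set" and g h :: "int \<Rightarrow> complex"
  assumes "a > 0" and "M > 0"
    and "int_interval Ig" and "finite Ig" and "card Ig = Lg"
    and "int_interval Ih" and "finite Ih" and "card Ih = Lh"
    and "Ig \<inter> Ih \<noteq> {}"
    and "g \<in> ell2" and "supp g \<subseteq> Ig"
    and "h \<in> ell2" and "supp h \<subseteq> Ih"
  shows "(finite {(m, n). m \<in> {0..<int a} \<and> \<not> wexler_raz_trivial Ig Ih M m n} \<and>
          int (card {(m, n). m \<in> {0..<int a} \<and> \<not> wexler_raz_trivial Ig Ih M m n})
            \<le> int a * \<lceil>real (Lg + Lh) / real M\<rceil> \<and>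
          (\<forall>m\<in>{0..<int a}. \<forall>n. wexler_raz_trivial Ig Ih M m n \<longrightarrow>
             wexler_raz_lhs g h a M m n = 0 \<and> wexler_raz_rhs m n = 0))
       \<and> (ell2_inner h g = of_nat a / of_nat M \<longrightarrow>
            (ell2_dual_windows g h a M \<longleftrightarrow>
             (\<forall>L::nat. L > Lg + Lh \<and> a dvd L \<and> M dvd L \<longrightarrow>
                fin_dual_windows L (periodization L g) (periodization L h) a M)))
       \<and> (ell2_dual_windows g h a M \<longrightarrow>
            (\<forall>L::nat. L \<ge> max Lg Lh \<and> a dvd L \<and> M dvd L \<longrightarrow>
                fin_dual_windows L (periodization L g) (periodization L h) a M))"
proof -
  have gI: "{x. g x \<noteq> 0} \<subseteq> Ig" and hI: "{x. h x \<noteq> 0} \<subseteq> Ih"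
    using order.trans [OF supp_superset assms(11)] order.trans [OF supp_superset assms(13)] .
  have fin: "finite {x. g x \<noteq> 0}" "finite {x. h x \<noteq> 0}"
    using finite_subset [OF gI assms(4)] finite_subset [OF hI assms(7)] .
  \<comment> \<open>Guarantees that every \<open>L \<ge> max Lg Lh\<close> is positive.\<close>
  have pos: "Lg > 0" using assms(4,5,9) card_gt_0_iff by blast
  note dual = ell2_dual_windows_iff [OF assms(1,2) gI assms(4) hI assms(7,9,10,12)]
    and fin_dual = fin_dual_windows_iff [OF _ assms(2) _ periodization_periodic periodization_periodic]
  have to_fin: "fin_dual_windows L (periodization L g) (periodization L h) a M"
    if "ell2_dual_windows g h a M" "L \<ge> max Lg Lh" "a dvd L" "M dvd L" for L
    using that pos by (auto simp: dual fin_dual intro: fin_corr_cond_if_corr_cond [OF fin assms(1)])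
  have from_fin: "ell2_dual_windows g h a M"
    if *: "\<And>L. L > Lg + Lh \<Longrightarrow> a dvd L \<Longrightarrow> M dvd L \<Longrightarrow>
            fin_dual_windows L (periodization L g) (periodization L h) a M"
  proof -
    \<comment> \<open>A common multiple of \<open>a\<close> and \<open>M\<close> exceeding
      \<open>Lg + Lh\<close>; duality for this single length already yields duality on the
      integers.\<close>
    define L where "L = a * M * (Lg + Lh + 1)"
    have "1 * (Lg + Lh + 1) \<le> L" unfolding L_def using assms(1,2) by (intro mult_right_mono) auto
    then have L: "L > Lg + Lh" by simp
    have d: "a dvd L" "M dvd L" by (auto simp: L_def)
    from * [OF L d] have "fin_corr_cond L (periodization L g) (periodization L h) a M"
      using fin_dual L d by auto
    then show ?thesis unfolding dual
      by (rule corr_cond_if_fin_corr_cond [rotated -1])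
        (use gI hI assms L d in auto)
  qed
  show ?thesis
    using nontrivial_wexler_raz_count [OF assms(2,3,4,6,7,9), of a, unfolded assms(5,8)]
      trivial_wexler_raz_holds [OF gI hI] to_fin from_fin
    by (intro conjI impI allI ballI iffI) auto
qed

end
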